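(* For every $\alpha_0\in(0,1)$, the sequence of functions $\alpha\mapsto n^{1-\alpha}g_n(\alpha)$, $n\ge 1$, converges uniformly on the interval $(\alpha_0,1)$ as $n\to\infty$.
   Context: Let $\mathbb{D}$ be the open unit disk in $\mathbb{C}$. For $\alpha\in(0,1)$ let $f_\alpha(z)=\frac{1}{2\alpha}\left(\left(\frac{1+z}{1-z}\right)^\alpha-1\right)$, $z\in\mathbb{D}$ (principal branch of the power), and let $\{g_n(\alpha)\}_{n\ge 0}$ be its sequence of Taylor coefficients at the origin, i.e. $f_\alpha(z)=\sum_{n\ge0}g_n(\alpha)z^n$. *)

theory Defs
  imports "HOL-Complex_Analysis.Complex_Analysis"
begin

text \<open>On complex arguments, \<open>powr\<close> is the principal branch of the power.\<close>

definition f_alpha :: "real \<Rightarrow> complex \<Rightarrow> complex" where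
  "f_alpha \<alpha> z = 1 / (2 * of_real \<alpha>) * (((1 + z) / (1 - z)) powr of_real \<alpha> - 1)"

definition g_coeff :: "nat \<Rightarrow> real \<Rightarrow> complex" where
  "g_coeff n \<alpha> = fps_nth (fps_expansion (f_alpha \<alpha>) 0) n"

lemma f_alpha_holomorphic: "f_alpha \<alpha> holomorphic_on ball 0 1"
proof -
  have nz: "1 - z \<noteq> 0" if "z \<in> ball 0 1" for z :: complex
    using that by auto
  have dom: "(1 + z) / (1 - z) \<notin> \<real>\<^sub>\<le>\<^sub>0" if z: "z \<in> ball 0 1" for z :: complex
  proof
    assume "(1 + z) / (1 - z) \<in> \<real>\<^sub>\<le>\<^sub>0"
    then obtain r where r: "r \<le> 0" "(1 + z) / (1 - z) = of_real r"
      by (auto elim!: nonpos_Reals_cases)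
    then have "1 + z = of_real r * (1 - z)"
      using nz[OF z] by (simp add: field_simps)
    then have "z * of_real (1 + r) = of_real (r - 1)"
      by (simp add: algebra_simps)
    then have "cmod z * \<bar>1 + r\<bar> = \<bar>r - 1\<bar>"
      by (metis norm_mult norm_of_real)
    moreover have "cmod z * \<bar>1 + r\<bar> \<le> 1 * \<bar>1 + r\<bar>"
      using z by (intro mult_right_mono) auto
    ultimately have "r = 0" using r(1) by auto
    then show False
      using \<open>cmod z * \<bar>1 + r\<bar> = \<bar>r - 1\<bar>\<close> z by auto
  qed
  show ?thesis
    unfolding f_alpha_def using nz dom by (intro holomorphic_intros) auto
qed

lemma f_alpha_eq_power_series:
  assumes "z \<in> ball 0 1"
  shows "(\<lambda>n. g_coeff n \<alpha> * z ^ n) sums f_alpha \<alpha> z"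
  using holomorphic_power_series[OF f_alpha_holomorphic assms]
  by (simp add: g_coeff_def fps_expansion_def)

end

theory Submission
  imports Defs
begin

text \<open>
  Put \<open>h\<^sub>n = n powr (1 - \<alpha>) * g\<^sub>n\<close>. The singularity of the generating function at \<open>z = 1\<close> makes
  \<open>h\<^sub>n\<close> converge, while the one at \<open>z = -1\<close> adds an alternating term of order
  \<open>n powr (- 2 * \<alpha>)\<close>. Because of that term the differences \<open>h\<^sub>n\<^sub>+\<^sub>1 - h\<^sub>n\<close> are not absolutely
  summable when \<open>\<alpha> \<le> 1/2\<close>, so the alternating part has to be split off before the Weierstrass
  M-test can be applied.

  The differential equation \<open>(1 - z\<^sup>2) f' = 2 \<alpha> f + 1\<close> gives the three-term recurrence
  \<open>(n + 2) g\<^sub>n\<^sub>+\<^sub>2 = 2 \<alpha> g\<^sub>n\<^sub>+\<^sub>1 + n g\<^sub>n\<close>, from which everything else is derived by real inequalities.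
  Consider the sum and the difference of two consecutive values of \<open>n g\<^sub>n\<close>,
    \<open>S\<^sub>n = (n + 1) g\<^sub>n\<^sub>+\<^sub>1 + n g\<^sub>n\<close> and \<open>e\<^sub>n = (n + 1) g\<^sub>n\<^sub>+\<^sub>1 - n g\<^sub>n\<close>,
  so that \<open>h\<^sub>n = n powr (- \<alpha>) * (S\<^sub>n - e\<^sub>n) / 2\<close>. The sum absorbs the alternation, and the
  difference contains it. Three facts, all uniform in \<open>\<alpha> \<in> (0, 1]\<close>, suffice.

  \<^item> \<open>0 \<le> n g\<^sub>n \<le> n powr \<alpha>\<close>, by induction on the recurrence; the step is the inequality
    \<open>2 \<alpha> u \<le> (1 + u) powr \<alpha> - (1 - u) powr \<alpha>\<close>, which rests on the convexity of \<open>x powr (\<alpha> - 1)\<close>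
    (\<open>powr_central_difference_ge\<close>, \<open>real_g_coeff_le_powr\<close>). Hence \<open>n powr (- \<alpha>) * S\<^sub>n\<close> is bounded.

  \<^item> \<open>\<bar>e\<^sub>n\<bar> \<le> 2\<close> (\<open>abs_osc_le\<close>), so \<open>n powr (- \<alpha>) * e\<^sub>n\<close> tends to \<open>0\<close> uniformly for \<open>\<alpha> > \<alpha>\<^sub>0 > 0\<close>.

  \<^item> The recurrence says \<open>S\<^sub>n\<^sub>+\<^sub>1 = S\<^sub>n + 2 \<alpha> g\<^sub>n\<^sub>+\<^sub>1 = S\<^sub>n (1 + \<alpha> / (n + 1)) + \<alpha> e\<^sub>n / (n + 1)\<close>. Up to a
    relative error of order \<open>n powr (- 2)\<close> the factor is \<open>((n + 1) / n) powr \<alpha>\<close>, so the increments of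
    \<open>n powr (- \<alpha>) * S\<^sub>n\<close> are bounded by a multiple of \<open>n powr (- 1 - \<alpha>)\<close> (\<open>psum_increment_le\<close>).
    For \<open>\<alpha> > \<alpha>\<^sub>0\<close> this has a summable majorant, and the M-test applies.
\<close>

section \<open>The recurrence for the Taylor coefficients\<close>

text \<open>
  The coefficients are real, but as Taylor coefficients of a complex function they have complex
  type. This real copy, defined by the recurrence, is what the inequalities below are about.
\<close>

fun real_g_coeff :: "real \<Rightarrow> nat \<Rightarrow> real" where
  "real_g_coeff \<alpha> 0 = 0"
| "real_g_coeff \<alpha> (Suc 0) = 1"
| "real_g_coeff \<alpha> (Suc (Suc n)) =
     (2 * \<alpha> * real_g_coeff \<alpha> (Suc n) + real n * real_g_coeff \<alpha> n) / (real n + 2)"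

text \<open>
  With \<open>q = (1 + z) / (1 - z)\<close> one has \<open>q' / q = 2 / (1 - z\<^sup>2)\<close>, and \<open>2 \<alpha> f + 1 = q powr \<alpha>\<close>. A
  neighbourhood of the origin is enough for comparing power series, and there \<open>q\<close> is close to
  \<open>1\<close> and hence off the branch cut.
\<close>

lemma f_alpha_ode:
  assumes "\<alpha> \<noteq> 0"
  shows "eventually (\<lambda>z. deriv (f_alpha \<alpha>) z - z ^ 2 * deriv (f_alpha \<alpha>) z
           = 2 * of_real \<alpha> * f_alpha \<alpha> z + 1) (nhds 0)"
proof -
  let ?q = "\<lambda>z::complex. (1 + z) / (1 - z)"
  have "(?q \<longlongrightarrow> ?q 0) (nhds 0)"
    by (intro tendsto_intros filterlim_ident) auto
  then have "eventually (\<lambda>z. ?q z \<in> - \<real>\<^sub>\<le>\<^sub>0) (nhds 0)"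
    by (rule topological_tendstoD) (auto simp: closed_nonpos_Reals_complex open_Compl)
  moreover have "eventually (\<lambda>z::complex. z \<in> - {1, -1}) (nhds 0)"
    by (rule eventually_nhds_in_open) (auto intro!: open_Compl)
  ultimately show ?thesis
  proof eventually_elim
    case (elim z)
    then have q: "?q z \<notin> \<real>\<^sub>\<le>\<^sub>0" and "1 - z \<noteq> 0" by auto
    moreover have "1 + z \<noteq> 0"
      using elim by (metis ComplD add.commute eq_neg_iff_add_eq_0 insertCI)
    ultimately have nz: "1 - z \<noteq> 0" "1 + z \<noteq> 0" by auto
    have q0: "?q z \<noteq> 0" using nz by simp
    have dq: "(?q has_field_derivative 2 / (1 - z) ^ 2) (at z)"
      using nz by (auto intro!: derivative_eq_intros simp: power2_eq_square)
    have "((\<lambda>w. ?q w powr of_real \<alpha>) has_field_derivative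
            of_real \<alpha> * ?q z powr (of_real \<alpha> - 1) * (2 / (1 - z) ^ 2)) (at z)"
      by (rule DERIV_chain2[OF has_field_derivative_powr[OF q] dq])
    then have "(f_alpha \<alpha> has_field_derivative
        1 / (2 * of_real \<alpha>) * (of_real \<alpha> * ?q z powr (of_real \<alpha> - 1) * (2 / (1 - z) ^ 2) - 0)) (at z)"
      unfolding f_alpha_def by (intro DERIV_cmult DERIV_diff DERIV_const)
    then have "deriv (f_alpha \<alpha>) z = ?q z powr of_real \<alpha> / ?q z * (1 / (1 - z) ^ 2)"
      using assms q0 by (simp add: DERIV_imp_deriv powr_diff)
    also have "\<dots> = ?q z powr of_real \<alpha> / ((1 + z) * (1 - z))"
    proof -
      have "p / (b / c) * (1 / c ^ 2) = p / (b * c)" if "b \<noteq> 0" "c \<noteq> 0" for b c p :: complex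
        using that by (simp add: field_simps power2_eq_square)
      from this[OF nz(2,1)] show ?thesis .
    qed
    finally have "((1 + z) * (1 - z)) * deriv (f_alpha \<alpha>) z = ?q z powr of_real \<alpha>"
      using nz by simp
    also have "\<dots> = 2 * of_real \<alpha> * f_alpha \<alpha> z + 1"
      using assms by (simp add: f_alpha_def)
    finally show ?case by (simp add: algebra_simps power2_eq_square)
  qed
qed

lemma g_coeff_eq_real_g_coeff:
  assumes "\<alpha> \<noteq> 0"
  shows "g_coeff n \<alpha> = of_real (real_g_coeff \<alpha> n)"
proof -
  define G where "G = fps_expansion (f_alpha \<alpha>) 0"
  have G: "f_alpha \<alpha> has_fps_expansion G"
    unfolding G_def by (rule has_fps_expansion_fps_expansion[OF _ _ f_alpha_holomorphic]) auto
  have "(\<lambda>z. deriv (f_alpha \<alpha>) z - z ^ 2 * deriv (f_alpha \<alpha>) z) has_fps_expansion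
          fps_deriv G - fps_X ^ 2 * fps_deriv G"
    by (intro fps_expansion_intros G)
  then have "(\<lambda>z. 2 * of_real \<alpha> * f_alpha \<alpha> z + 1) has_fps_expansion
          fps_deriv G - fps_X ^ 2 * fps_deriv G"
    using has_fps_expansion_cong[OF f_alpha_ode[OF assms] refl] by blast
  moreover have "(\<lambda>z. 2 * of_real \<alpha> * f_alpha \<alpha> z + 1) has_fps_expansion
          fps_const (2 * of_real \<alpha>) * G + 1"
    by (intro fps_expansion_intros G)
  ultimately have eq: "fps_deriv G - fps_X ^ 2 * fps_deriv G = fps_const (2 * of_real \<alpha>) * G + 1"
    by (rule fps_expansion_unique_complex)
  have G0: "fps_nth G 0 = 0"
    by (simp add: G_def fps_expansion_def f_alpha_def)
  have G1: "fps_nth G (Suc 0) = 1"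
    using arg_cong[OF eq, of "\<lambda>F. fps_nth F 0"] G0 by simp
  have rec: "of_nat (Suc (Suc n)) * fps_nth G (Suc (Suc n))
      = 2 * of_real \<alpha> * fps_nth G (Suc n) + of_nat n * fps_nth G n" for n
  proof -
    have "fps_nth (fps_X ^ 2 * fps_deriv G) (Suc n) = of_nat n * fps_nth G n"
      by (cases n) (auto simp: fps_X_power_mult_nth)
    then show ?thesis
      using arg_cong[OF eq, of "\<lambda>F. fps_nth F (Suc n)"] by (simp add: algebra_simps)
  qed
  have "fps_nth G n = of_real (real_g_coeff \<alpha> n)"
  proof (induction n rule: induct_nat_012)
    case (ge2 n)
    have "(of_nat n + 2) * fps_nth G (Suc (Suc n)) =
        2 * of_real \<alpha> * fps_nth G (Suc n) + of_nat n * fps_nth G n"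
      using rec[of n] by (simp add: add.commute)
    moreover have "(of_nat n + 2 :: complex) \<noteq> 0"
      by (metis of_nat_add of_nat_numeral of_nat_eq_0_iff add_is_0 zero_neq_numeral)
    ultimately show ?case using ge2 by (simp add: field_simps)
  qed (use G0 G1 in auto)
  then show ?thesis by (simp add: g_coeff_def G_def)
qed

section \<open>A sharp growth bound\<close>

text \<open>
  The function \<open>\<phi>\<close>, the difference of the two sides, vanishes at \<open>0\<close>, and its derivative is
  \<open>\<alpha> (P + Q - 2)\<close> with \<open>P = (1 + x) powr (\<alpha> - 1)\<close> and \<open>Q = (1 - x) powr (\<alpha> - 1)\<close>. Since
  \<open>P Q = (1 - x\<^sup>2) powr (\<alpha> - 1) \<ge> 1\<close>, the inequality between arithmetic and geometric means gives
  \<open>P + Q \<ge> 2\<close>. The mean value theorem needs differentiability only in the open interval, so the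
  end point \<open>u = 1\<close>, where \<open>Q\<close> blows up, is included; it is needed for the coefficient of index \<open>2\<close>.
\<close>

lemma powr_central_difference_ge:
  fixes \<alpha> u :: real
  assumes \<alpha>: "0 < \<alpha>" "\<alpha> \<le> 1" and u: "0 < u" "u \<le> 1"
  shows "2 * \<alpha> * u \<le> (1 + u) powr \<alpha> - (1 - u) powr \<alpha>"
proof -
  define \<phi> where "\<phi> x = (1 + x) powr \<alpha> - (1 - x) powr \<alpha> - 2 * \<alpha> * x" for x
  have "continuous_on {0..u} \<phi>"
    unfolding \<phi>_def using \<alpha> u by (intro continuous_intros continuous_on_powr') auto
  moreover have der: "(\<phi> has_real_derivative
      \<alpha> * ((1 + x) powr (\<alpha> - 1) + (1 - x) powr (\<alpha> - 1) - 2)) (at x)" if "0 < x" "x < u" for x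
    unfolding \<phi>_def using that u
    by (auto intro!: derivative_eq_intros simp: algebra_simps powr_diff)
  ultimately obtain l z where z: "0 < z" "z < u" "DERIV \<phi> z :> l" "\<phi> u - \<phi> 0 = (u - 0) * l"
    using MVT[of 0 u \<phi>] u(1) by (auto simp: real_differentiable_def)
  define P Q where "P = (1 + z) powr (\<alpha> - 1)" and "Q = (1 - z) powr (\<alpha> - 1)"
  have l: "l = \<alpha> * (P + Q - 2)"
    unfolding P_def Q_def by (rule DERIV_unique[OF z(3) der[OF z(1,2)]])
  have "P * Q = (1 - z\<^sup>2) powr (\<alpha> - 1)"
    unfolding P_def Q_def using z u
    by (subst powr_mult[symmetric]) (auto simp: algebra_simps power2_eq_square)
  also have "\<dots> \<ge> 1 powr (\<alpha> - 1)"
    using z u \<alpha> by (intro powr_mono2') (auto simp: abs_square_less_1)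
  finally have "1 \<le> P * Q" by simp
  moreover have "4 * (P * Q) \<le> (P + Q)\<^sup>2"
    using zero_le_power2[of "P - Q"] by (simp add: algebra_simps power2_eq_square)
  ultimately have "2\<^sup>2 \<le> (P + Q)\<^sup>2" by simp
  then have "2 \<le> P + Q"
    by (rule power2_le_imp_le) (simp add: P_def Q_def)
  then have "0 \<le> \<phi> u - \<phi> 0"
    using z(4) l \<alpha> u by simp
  then show ?thesis by (simp add: \<phi>_def)
qed

lemma real_g_coeff_nonneg: "0 \<le> \<alpha> \<Longrightarrow> 0 \<le> real_g_coeff \<alpha> n"
  by (induction \<alpha> n rule: real_g_coeff.induct) auto

text \<open>
  The constant \<open>1\<close> is exactly what the induction reproduces. With \<open>m = n + 1\<close> the recurrence and the
  hypotheses for \<open>n\<close> and \<open>m\<close> bound the new term by \<open>2 \<alpha> m powr (\<alpha> - 1) + (m - 1) powr \<alpha>\<close>, which is at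
  most \<open>(m + 1) powr \<alpha>\<close> by the preceding inequality with \<open>u = 1 / m\<close>. At \<open>n = 0\<close> both sides
  vanish.
\<close>

lemma real_g_coeff_le_powr:
  assumes \<alpha>: "0 < \<alpha>" "\<alpha> \<le> 1"
  shows "real n * real_g_coeff \<alpha> n \<le> real n powr \<alpha>"
proof (induction n rule: induct_nat_012)
  case (ge2 n)
  define m where "m = real n + 1"
  have m: "m \<ge> 1" by (simp add: m_def)
  have "real_g_coeff \<alpha> (Suc n) \<le> m powr \<alpha> / m"
    using ge2(2) m by (simp add: m_def field_simps)
  then have "2 * \<alpha> * real_g_coeff \<alpha> (Suc n) \<le> 2 * \<alpha> * (m powr \<alpha> / m)"
    using \<alpha> by (intro mult_left_mono) auto
  also have "\<dots> = m powr \<alpha> * (2 * \<alpha> * (1 / m))" by simp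
  also have "\<dots> \<le> m powr \<alpha> * ((1 + 1 / m) powr \<alpha> - (1 - 1 / m) powr \<alpha>)"
    using \<alpha> m by (intro mult_left_mono powr_central_difference_ge) auto
  also have "\<dots> = (m * (1 + 1 / m)) powr \<alpha> - (m * (1 - 1 / m)) powr \<alpha>"
    by (simp only: powr_mult right_diff_distrib[of "m powr \<alpha>"])
  also have "m * (1 + 1 / m) = real (Suc (Suc n))"
    using m by (simp add: m_def field_simps)
  also have "m * (1 - 1 / m) = real n"
    using m by (simp add: m_def field_simps)
  finally show ?case using ge2(1) by (simp add: add.commute)
qed auto

lemma real_g_coeff_le_1:
  assumes \<alpha>: "0 < \<alpha>" "\<alpha> \<le> 1"
  shows "real_g_coeff \<alpha> n \<le> 1"
proof (cases "n = 0")
  case False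
  have "real n * real_g_coeff \<alpha> n \<le> real n powr \<alpha>" by (rule real_g_coeff_le_powr[OF \<alpha>])
  also have "\<dots> \<le> real n powr 1" using \<alpha> False by (intro powr_mono) auto
  finally show ?thesis using False by simp
qed auto

section \<open>Splitting off the alternating part\<close>

text \<open>
  The names refer to the roles of the two sequences: by \<open>psum_Suc\<close> below, \<open>psum \<alpha> n\<close> equals \<open>1\<close> plus
  \<open>2 \<alpha>\<close> times the sum of the coefficients up to index \<open>n\<close>, and \<open>osc\<close> carries the oscillation
  caused by the singularity at \<open>z = -1\<close>.
\<close>

definition psum :: "real \<Rightarrow> nat \<Rightarrow> real" where
  "psum \<alpha> n = real (Suc n) * real_g_coeff \<alpha> (Suc n) + real n * real_g_coeff \<alpha> n"

definition osc :: "real \<Rightarrow> nat \<Rightarrow> real" where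
  "osc \<alpha> n = real (Suc n) * real_g_coeff \<alpha> (Suc n) - real n * real_g_coeff \<alpha> n"

lemma real_g_coeff_Suc_Suc_mult:
  "real (Suc (Suc n)) * real_g_coeff \<alpha> (Suc (Suc n))
     = 2 * \<alpha> * real_g_coeff \<alpha> (Suc n) + real n * real_g_coeff \<alpha> n"
  by (simp add: field_simps)

lemma psum_Suc: "psum \<alpha> (Suc n) = psum \<alpha> n + 2 * \<alpha> * real_g_coeff \<alpha> (Suc n)"
  unfolding psum_def real_g_coeff_Suc_Suc_mult by simp

lemma real_g_coeff_Suc_eq_psum_osc: "2 * real (Suc n) * real_g_coeff \<alpha> (Suc n) = psum \<alpha> n + osc \<alpha> n"
  by (simp add: psum_def osc_def)

text \<open>
  Since \<open>n g\<^sub>n\<close> grows like a multiple of \<open>n powr \<alpha>\<close>, its difference \<open>osc \<alpha> n\<close> has the monotone part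
  \<open>\<alpha> g\<^sub>n\<close> to first order. After its removal what remains changes sign at each step up to a damping
  factor and a small perturbation.
\<close>

lemma osc_Suc:
  "osc \<alpha> (Suc n) - \<alpha> * real_g_coeff \<alpha> (Suc n)
     = - (1 - \<alpha> / real (Suc n)) * (osc \<alpha> n - \<alpha> * real_g_coeff \<alpha> n)
       - \<alpha> * (1 - \<alpha>) / real (Suc n) * real_g_coeff \<alpha> n"
proof -
  define x y N where "x = real_g_coeff \<alpha> n" and "y = real_g_coeff \<alpha> (Suc n)" and "N = real (Suc n)"
  have N: "N > 0" "real n = N - 1" by (simp_all add: N_def)
  have "2 * \<alpha> * y + (N - 1) * x - N * y - \<alpha> * y
     = - (1 - \<alpha> / N) * (N * y - (N - 1) * x - \<alpha> * x) - \<alpha> * (1 - \<alpha>) / N * x"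
    using N(1) by (simp add: field_simps)
  then show ?thesis
    unfolding osc_def real_g_coeff_Suc_Suc_mult
    by (simp add: x_def y_def N_def del: real_g_coeff.simps)
qed

text \<open>
  In the preceding identity the moduli of the two coefficients sum to \<open>1 - \<alpha>\<^sup>2 / (n + 1) \<le> 1\<close>, and the
  Taylor coefficients lie between \<open>0\<close> and \<open>1\<close>. Hence the bound \<open>1\<close> for \<open>osc \<alpha> n - \<alpha> g\<^sub>n\<close> is inherited from
  each index to the next.
\<close>

lemma abs_osc_le:
  assumes \<alpha>: "0 < \<alpha>" "\<alpha> \<le> 1"
  shows "\<bar>osc \<alpha> n\<bar> \<le> 2"
proof -
  have "\<bar>osc \<alpha> n - \<alpha> * real_g_coeff \<alpha> n\<bar> \<le> 1"
  proof (induction n)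
    case 0
    then show ?case by (simp add: osc_def)
  next
    case (Suc n)
    define N where "N = real (Suc n)"
    have N: "N \<ge> 1" by (simp add: N_def)
    have c: "0 \<le> 1 - \<alpha> / N" "0 \<le> \<alpha> * (1 - \<alpha>) / N"
      using N \<alpha> by (auto simp: field_simps)
    have "\<bar>osc \<alpha> (Suc n) - \<alpha> * real_g_coeff \<alpha> (Suc n)\<bar>
        \<le> (1 - \<alpha> / N) * \<bar>osc \<alpha> n - \<alpha> * real_g_coeff \<alpha> n\<bar> + \<alpha> * (1 - \<alpha>) / N * real_g_coeff \<alpha> n"
      unfolding osc_Suc N_def[symmetric]
      using c N real_g_coeff_nonneg[of \<alpha> n] \<alpha>
      by (intro order.trans[OF abs_triangle_ineq4]) (simp add: abs_mult)
    also have "\<dots> \<le> (1 - \<alpha> / N) * 1 + \<alpha> * (1 - \<alpha>) / N * 1"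
      using c Suc real_g_coeff_le_1[OF \<alpha>] by (intro add_mono mult_left_mono) auto
    also have "\<dots> \<le> 1"
      using N \<alpha> by (simp add: field_simps)
    finally show ?case .
  qed
  moreover have "0 \<le> \<alpha> * real_g_coeff \<alpha> n" "\<alpha> * real_g_coeff \<alpha> n \<le> 1"
    using \<alpha> real_g_coeff_nonneg[of \<alpha> n] real_g_coeff_le_1[OF \<alpha>, of n] by (auto intro: mult_le_one)
  ultimately show ?thesis by linarith
qed

section \<open>Increments of the scaled sums\<close>

text \<open>
  Bernoulli's inequality for an exponent in the unit interval is the weighted inequality between
  arithmetic and geometric means for the numbers \<open>1 - u\<close> and \<open>1\<close>.
\<close>

lemma one_minus_powr_le:
  fixes \<beta> u :: real
  assumes "0 \<le> \<beta>" "\<beta> \<le> 1" "0 \<le> u" "u < 1"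
  shows "(1 - u) powr \<beta> \<le> 1 - \<beta> * u"
  using Youngs_inequality_0[of \<beta> "1 - \<beta>" "1 - u" 1] assms by (simp add: algebra_simps)

text \<open>
  The first-order terms cancel. A bound with a constant independent of \<open>\<alpha>\<close> comes from Bernoulli's
  inequality on both sides: directly for the upper estimate, and for the lower one through
  \<open>(1 - u) powr \<alpha> = (1 - u) / (1 - u) powr (1 - \<alpha>)\<close>.
\<close>

lemma powr_second_order_bound:
  fixes \<alpha> u :: real
  assumes \<alpha>: "0 < \<alpha>" "\<alpha> \<le> 1" and u: "0 \<le> u" "u \<le> 1 / 2"
  shows "\<bar>(1 - u) powr \<alpha> * (1 + \<alpha> * u) - 1\<bar> \<le> 2 * u\<^sup>2"
proof -
  define s where "s = 1 - \<alpha>"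
  have s: "0 \<le> s" "s \<le> 1" using \<alpha> by (auto simp: s_def)
  have au: "0 \<le> \<alpha> * u" using \<alpha> u by simp
  have su: "s * u \<le> 1 / 2" using mult_mono[of s 1 u "1/2"] s u by simp
  have "(1 - u) powr \<alpha> * (1 + \<alpha> * u) \<le> (1 - \<alpha> * u) * (1 + \<alpha> * u)"
    using one_minus_powr_le[of \<alpha> u] \<alpha> u au by (intro mult_right_mono) auto
  also have "\<dots> \<le> 1" using \<alpha> u by (simp add: algebra_simps)
  finally have upper: "(1 - u) powr \<alpha> * (1 + \<alpha> * u) - 1 \<le> 0" by simp
  have "1 - u = (1 - u) powr \<alpha> * (1 - u) powr s"
    using u by (simp add: s_def flip: powr_add)
  also have "\<dots> \<le> (1 - u) powr \<alpha> * (1 - s * u)"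
    using one_minus_powr_le[of s u] s u by (intro mult_left_mono) auto
  finally have "(1 - u) / (1 - s * u) \<le> (1 - u) powr \<alpha>"
    using su by (simp add: divide_le_eq)
  then have "(1 - u) / (1 - s * u) * (1 + \<alpha> * u) \<le> (1 - u) powr \<alpha> * (1 + \<alpha> * u)"
    using au by (intro mult_right_mono) auto
  moreover have "(1 - u) / (1 - s * u) * (1 + \<alpha> * u) - 1 = - (\<alpha> * u\<^sup>2) / (1 - s * u)"
    using su by (simp add: divide_simps s_def) (simp add: algebra_simps power2_eq_square)
  moreover have "\<alpha> * u\<^sup>2 / (1 - s * u) \<le> 1 * u\<^sup>2 / (1 / 2)"
    using su \<alpha> by (intro frac_le mult_right_mono) auto
  ultimately show ?thesis using upper by simp
qed

text \<open>
  Let \<open>u = 1 / (n + 1)\<close> and \<open>A = n powr (- \<alpha>) * psum \<alpha> n\<close>, which lies between \<open>0\<close> and \<open>3\<close>. The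
  recurrence turns the increment into \<open>A ((1 - u) powr \<alpha> (1 + \<alpha> u) - 1)\<close> plus
  \<open>(n + 1) powr (- \<alpha>) u \<alpha> osc \<alpha> n\<close>. The first part is at most \<open>6 u\<^sup>2\<close>, and the second at most
  \<open>2 u (n + 1) powr (- \<alpha>)\<close>; together they account for the constant \<open>8\<close>.
\<close>

lemma psum_increment_le:
  assumes \<alpha>: "0 < \<alpha>" "\<alpha> \<le> 1"
  shows "\<bar>real (Suc n) powr - \<alpha> * psum \<alpha> (Suc n) - real n powr - \<alpha> * psum \<alpha> n\<bar>
           \<le> 8 * real (Suc n) powr (- 1 - \<alpha>)"
proof (cases "n = 0")
  case True
  \<comment> \<open>Here \<open>0 powr - \<alpha> = 0\<close>, so the increment is just \<open>psum \<alpha> 1 = 1 + 2 * \<alpha>\<close>.\<close>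
  then show ?thesis using \<alpha> by (simp add: psum_def)
next
  case False
  define N u where "N = real (Suc n)" and "u = 1 / N"
  have N: "N \<ge> 2" "real n = N - 1" using False by (auto simp: N_def)
  have u: "0 < u" "u \<le> 1 / 2" using N by (auto simp: u_def field_simps)
  have n: "real n = N * (1 - u)"
    unfolding N(2) using N(1) by (simp add: u_def field_simps)
  define A where "A = real n powr - \<alpha> * psum \<alpha> n"
  have np: "real n powr - \<alpha> * real n powr \<alpha> = 1"
    using False by (simp flip: powr_add)
  have "psum \<alpha> n \<le> N powr \<alpha> + real n powr \<alpha>"
    unfolding psum_def N_def by (intro add_mono real_g_coeff_le_powr \<alpha>)
  also have "N powr \<alpha> \<le> (2 * real n) powr \<alpha>"
    using N \<alpha> by (intro powr_mono2) auto
  also have "(2 * real n) powr \<alpha> = 2 powr \<alpha> * real n powr \<alpha>"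
    by (simp add: powr_mult)
  also have "\<dots> \<le> 2 powr 1 * real n powr \<alpha>"
    using \<alpha> by (intro mult_right_mono powr_mono) auto
  finally have "psum \<alpha> n \<le> 3 * real n powr \<alpha>" by simp
  then have "A \<le> real n powr - \<alpha> * (3 * real n powr \<alpha>)"
    unfolding A_def by (intro mult_left_mono) auto
  also have "\<dots> = 3" using np by simp
  finally have A3: "A \<le> 3" .
  have A0: "0 \<le> A"
    unfolding A_def psum_def using real_g_coeff_nonneg[of \<alpha>] \<alpha> by simp
  have Np: "N powr - \<alpha> = real n powr - \<alpha> * (1 - u) powr \<alpha>"
    using u N(1) unfolding n by (simp add: powr_mult powr_minus)
  have "psum \<alpha> (Suc n) = psum \<alpha> n + \<alpha> * u * (2 * N * real_g_coeff \<alpha> (Suc n))"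
    unfolding psum_Suc u_def using N by simp
  also have "2 * N * real_g_coeff \<alpha> (Suc n) = psum \<alpha> n + osc \<alpha> n"
    unfolding N_def by (rule real_g_coeff_Suc_eq_psum_osc)
  finally have "N powr - \<alpha> * psum \<alpha> (Suc n)
      = N powr - \<alpha> * psum \<alpha> n * (1 + \<alpha> * u) + N powr - \<alpha> * u * (\<alpha> * osc \<alpha> n)"
    by (simp add: algebra_simps)
  also have "N powr - \<alpha> * psum \<alpha> n = A * (1 - u) powr \<alpha>"
    by (simp add: Np A_def)
  finally have eq: "N powr - \<alpha> * psum \<alpha> (Suc n) - A
      = A * ((1 - u) powr \<alpha> * (1 + \<alpha> * u) - 1) + N powr - \<alpha> * u * (\<alpha> * osc \<alpha> n)"
    by (simp add: algebra_simps)
  have pw: "N powr - \<alpha> * u = N powr (- 1 - \<alpha>)"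
    using N by (simp add: u_def powr_diff powr_minus field_simps)
  have "u\<^sup>2 = N powr - 2"
    using N by (simp add: u_def powr_minus field_simps)
  also have "\<dots> \<le> N powr (- 1 - \<alpha>)"
    using N \<alpha> by (intro powr_mono) auto
  finally have u2: "u\<^sup>2 \<le> N powr (- 1 - \<alpha>)" .
  have "\<bar>A * ((1 - u) powr \<alpha> * (1 + \<alpha> * u) - 1)\<bar> \<le> 3 * (2 * u\<^sup>2)"
    unfolding abs_mult using A0 A3 powr_second_order_bound[OF \<alpha>, of u] u
    by (intro mult_mono) auto
  moreover have "\<bar>N powr - \<alpha> * u * (\<alpha> * osc \<alpha> n)\<bar> \<le> N powr (- 1 - \<alpha>) * (1 * 2)"
    unfolding pw abs_mult using \<alpha> abs_osc_le[OF \<alpha>, of n] by (intro mult_mono) auto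
  ultimately have "\<bar>N powr - \<alpha> * psum \<alpha> (Suc n) - A\<bar> \<le> 8 * N powr (- 1 - \<alpha>)"
    unfolding eq using u2 by linarith
  then show ?thesis by (simp add: A_def N_def)
qed

section \<open>Uniform convergence\<close>

lemma psum_scaled_uniformly_convergent:
  fixes a :: real
  assumes "0 < a"
  shows "uniformly_convergent_on {a<..<1} (\<lambda>n \<alpha>. real n powr - \<alpha> * psum \<alpha> n)"
proof -
  define D where "D n \<alpha> = real (Suc n) powr - \<alpha> * psum \<alpha> (Suc n) - real n powr - \<alpha> * psum \<alpha> n"
    for n \<alpha>
  have "summable (\<lambda>n. real (Suc n) powr (- 1 - a))"
    using assms by (subst summable_Suc_iff) (simp add: summable_real_powr_iff)
  then have summ: "summable (\<lambda>n. 8 * real (Suc n) powr (- 1 - a))"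
    by (rule summable_mult)
  have "norm (D n \<alpha>) \<le> 8 * real (Suc n) powr (- 1 - a)" if "\<alpha> \<in> {a<..<1}" for n \<alpha>
  proof -
    have "norm (D n \<alpha>) \<le> 8 * real (Suc n) powr (- 1 - \<alpha>)"
      using psum_increment_le[of \<alpha> n] that assms by (simp add: D_def)
    also have "\<dots> \<le> 8 * real (Suc n) powr (- 1 - a)"
      using that by (intro mult_left_mono powr_mono) auto
    finally show ?thesis .
  qed
  then have "uniformly_convergent_on {a<..<1} (\<lambda>n \<alpha>. \<Sum>k<n. D k \<alpha>)"
    by (rule Weierstrass_m_test'[OF _ summ])
  \<comment> \<open>The sum telescopes without a constant term because \<open>0 powr - \<alpha> = 0\<close>.\<close>
  moreover have "(\<Sum>k<n. D k \<alpha>) = real n powr - \<alpha> * psum \<alpha> n" for n \<alpha>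
    unfolding D_def by (subst sum_lessThan_telescope) simp
  ultimately show ?thesis by simp
qed

lemma osc_scaled_uniform_limit:
  fixes a :: real
  assumes "0 < a"
  shows "uniform_limit {a<..<1} (\<lambda>n \<alpha>. real n powr - \<alpha> * osc \<alpha> n) (\<lambda>_. 0) sequentially"
proof (rule uniform_limitI)
  fix e :: real assume e: "0 < e"
  have "(\<lambda>n. 2 * real n powr - a) \<longlonglongrightarrow> 2 * 0"
    using assms by (intro tendsto_intros tendsto_neg_powr filterlim_real_sequentially) auto
  then have "\<forall>\<^sub>F n in sequentially. 2 * real n powr - a < e"
    using e by (intro order_tendstoD) auto
  then show "\<forall>\<^sub>F n in sequentially. \<forall>\<alpha>\<in>{a<..<1}. dist (real n powr - \<alpha> * osc \<alpha> n) 0 < e"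
    using eventually_gt_at_top[of 0]
  proof eventually_elim
    case (elim n)
    show ?case
    proof
      fix \<alpha> assume \<alpha>: "\<alpha> \<in> {a<..<1}"
      have "dist (real n powr - \<alpha> * osc \<alpha> n) 0 = real n powr - \<alpha> * \<bar>osc \<alpha> n\<bar>"
        by (simp add: abs_mult)
      also have "\<dots> \<le> real n powr - a * 2"
        using \<alpha> assms elim abs_osc_le[of \<alpha> n] by (intro mult_mono powr_mono) auto
      also have "\<dots> < e" using elim by simp
      finally show "dist (real n powr - \<alpha> * osc \<alpha> n) 0 < e" .
    qed
  qed
qed

theorem theorem2p1:
  fixes \<alpha>\<^sub>0 :: real
  assumes "\<alpha>\<^sub>0 \<in> {0<..<1}"
  shows "uniformly_convergent_on {\<alpha>\<^sub>0<..<1}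
           (\<lambda>n \<alpha>. of_real (real n powr (1 - \<alpha>)) * g_coeff n \<alpha>)"
proof -
  have pos: "0 < \<alpha>\<^sub>0" using assms by simp
  obtain L where L: "uniform_limit {\<alpha>\<^sub>0<..<1} (\<lambda>n \<alpha>. real n powr - \<alpha> * psum \<alpha> n) L sequentially"
    using psum_scaled_uniformly_convergent[OF pos] by (auto simp: uniformly_convergent_on_def)
  have eq: "real n powr (1 - \<alpha>) * real_g_coeff \<alpha> n
      = (real n powr - \<alpha> * psum \<alpha> n - real n powr - \<alpha> * osc \<alpha> n) / 2" for n \<alpha>
    by (cases "n = 0") (simp_all add: psum_def osc_def powr_diff powr_minus field_simps)
  have "uniform_limit {\<alpha>\<^sub>0<..<1}
      (\<lambda>n \<alpha>. of_real ((real n powr - \<alpha> * psum \<alpha> n - real n powr - \<alpha> * osc \<alpha> n) / 2) :: complex)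
      (\<lambda>\<alpha>. of_real ((L \<alpha> - 0) / 2)) sequentially"
    by (intro bounded_linear.uniform_limit[OF bounded_linear_of_real]
        bounded_linear.uniform_limit[OF bounded_linear_divide]
        uniform_limit_minus L osc_scaled_uniform_limit pos)
  also have "?this \<longleftrightarrow> uniform_limit {\<alpha>\<^sub>0<..<1}
      (\<lambda>n \<alpha>. of_real (real n powr (1 - \<alpha>)) * g_coeff n \<alpha>)
      (\<lambda>\<alpha>. of_real ((L \<alpha> - 0) / 2)) sequentially"
    using pos by (intro uniform_limit_cong always_eventually) 
      (auto simp: eq g_coeff_eq_real_g_coeff simp flip: of_real_mult)
  finally show ?thesis by (rule uniformly_convergentI)
qed

end
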